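(* Let $\mathbf{R}=\langle R,+,\cdot,0,1,\alpha\rangle$ be a Łukasiewicz near semiring. Define $x\oplus y=\alpha\big((\alpha(x)+y)\cdot\alpha(y)\big)$ for $x,y\in R$. Then the structure $\mathbf{B}(\mathbf{R})=\langle R,\oplus,\alpha,0\rangle$ (with $\alpha$ playing the role of the unary operation $'$) is a basic algebra.
   Context: A near semiring is an algebra $\langle R,+,\cdot,0,1\rangle$ such that: (i) $\langle R,+,0\rangle$ is a commutative monoid; (ii) $x\cdot 1=x=1\cdot x$ (multiplication need not be associative or commutative); (iii) $(x+y)\cdot z=(x\cdot z)+(y\cdot z)$; (iv) $x\cdot 0=0\cdot x=0$. It is idempotent if $x+x=x$; then $x\le y$ iff $x+y=y$ defines a partial order, called the induced order. An involutive near semiring is an idempotent near semiring with a map $\alpha:R\to R$ such that $\alpha(\alpha(x))=x$, and $x\le y$ implies $\alpha(y)\le\alpha(x)$. A Łukasiewicz near semiring is an involutive near semiring satisfying the identity $\alpha(x\cdot\alpha(y))\cdot\alpha(y)=\alpha(y\cdot\alpha(x))\cdot\alpha(x)$. A basic algebra is an algebra $\langle A,\oplus,{}',0\rangle$ of type $\langle 2,1,0\rangle$ satisfying, with $1:=0'$: (BA1) $x\oplus 0=x$; (BA2) $x''=x$; (BA3) $(x'\oplus y)'\oplus y=(y'\oplus x)'\oplus x$; (BA4) $(((x\oplus y)'\oplus y)'\oplus z)'\oplus(x\oplus z)=1$. *)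

theory Defs
  imports Main
begin

text \<open>
  The carrier of every algebra is the whole type \<open>'a\<close>. No associativity or commutativity of
  multiplication is assumed, and distributivity is only required on one side, so the
  library's semiring classes do not apply.
\<close>

locale near_semiring =
  add: comm_monoid add zero
  for add :: "'a \<Rightarrow> 'a \<Rightarrow> 'a"  (infixl "\<^bold>+" 65)
    and mult :: "'a \<Rightarrow> 'a \<Rightarrow> 'a"  (infixl "\<^bold>\<cdot>" 70)
    and zero :: 'a  ("\<^bold>0")
    and one :: 'a  ("\<^bold>1") +
  assumes mult_one_right: "x \<^bold>\<cdot> \<^bold>1 = x"
    and mult_one_left: "\<^bold>1 \<^bold>\<cdot> x = x"
    and distrib_right: "(x \<^bold>+ y) \<^bold>\<cdot> z = (x \<^bold>\<cdot> z) \<^bold>+ (y \<^bold>\<cdot> z)"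
    and mult_zero_right: "x \<^bold>\<cdot> \<^bold>0 = \<^bold>0"
    and mult_zero_left: "\<^bold>0 \<^bold>\<cdot> x = \<^bold>0"

locale idempotent_near_semiring = near_semiring +
  assumes add_idem: "x \<^bold>+ x = x"
begin

definition induced_le :: "'a \<Rightarrow> 'a \<Rightarrow> bool"  (infix "\<^bold>\<le>" 50)
  where "x \<^bold>\<le> y \<longleftrightarrow> x \<^bold>+ y = y"

end

locale involutive_near_semiring = idempotent_near_semiring +
  fixes \<alpha> :: "'a \<Rightarrow> 'a"
  assumes involution: "\<alpha> (\<alpha> x) = x"
    and antitone: "x \<^bold>\<le> y \<Longrightarrow> \<alpha> y \<^bold>\<le> \<alpha> x"

locale lukasiewicz_near_semiring = involutive_near_semiring +
  assumes lukasiewicz: "\<alpha> (x \<^bold>\<cdot> \<alpha> y) \<^bold>\<cdot> \<alpha> y = \<alpha> (y \<^bold>\<cdot> \<alpha> x) \<^bold>\<cdot> \<alpha> x"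

locale basic_algebra =
  fixes oplus :: "'a \<Rightarrow> 'a \<Rightarrow> 'a"  (infixl "\<oplus>" 65)
    and neg :: "'a \<Rightarrow> 'a"
    and zero :: 'a  ("\<^bold>0")
  assumes BA1: "x \<oplus> \<^bold>0 = x"
    and BA2: "neg (neg x) = x"
    and BA3: "neg (neg x \<oplus> y) \<oplus> y = neg (neg y \<oplus> x) \<oplus> x"
    and BA4: "neg (neg (neg (x \<oplus> y) \<oplus> y) \<oplus> z) \<oplus> (x \<oplus> z) = neg \<^bold>0"
    \<comment> \<open>\<open>neg \<^bold>0\<close> is the constant \<open>1\<close> of the basic algebra.\<close>

end

theory Submission
  imports Defs
begin

text \<open>
  The Lukasiewicz identity with \<open>x = 1\<close> gives \<open>y \<cdot> \<alpha> y = 0\<close>, so \<open>x \<oplus> y\<close> collapses to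
  \<open>\<alpha> (\<alpha> x \<cdot> \<alpha> y)\<close>. Then BA3 is the Lukasiewicz identity itself, and BA4 reduces to
  \<open>\<alpha> (\<alpha> x \<cdot> \<alpha> y) \<cdot> \<alpha> y \<le> x\<close>, where the left side equals \<open>\<alpha> (y \<cdot> x) \<cdot> x\<close>.
\<close>

context idempotent_near_semiring
begin

lemma zero_le: "\<^bold>0 \<^bold>\<le> x"
  by (simp add: induced_le_def)

lemma le_zero_iff: "x \<^bold>\<le> \<^bold>0 \<longleftrightarrow> x = \<^bold>0"
  by (simp add: induced_le_def)

lemma mult_right_mono: "x \<^bold>\<le> y \<Longrightarrow> x \<^bold>\<cdot> z \<^bold>\<le> y \<^bold>\<cdot> z"
  by (metis induced_le_def distrib_right)

end

context involutive_near_semiring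
begin

text \<open>Negation turns the least element 0 into a greatest one. That this greatest element is 1
  follows only from the Lukasiewicz identity.\<close>

lemma le_alpha_zero: "x \<^bold>\<le> \<alpha> \<^bold>0"
  using antitone[OF zero_le, of "\<alpha> x"] by (simp add: involution)

end

context lukasiewicz_near_semiring
begin

text \<open>As 1 lies below the top element \<open>\<alpha> 0\<close>, its product with
  \<open>\<alpha> 1\<close> lies below a product that the Lukasiewicz identity forces to be
  0.\<close>

lemma alpha_one: "\<alpha> \<^bold>1 = \<^bold>0"
proof -
  have "\<alpha> \<^bold>0 \<^bold>\<cdot> \<alpha> \<^bold>1 = \<^bold>0"
    using lukasiewicz[of "\<^bold>1" "\<^bold>0"]
    by (simp add: mult_one_left mult_zero_left involution)
  then have "\<alpha> \<^bold>1 \<^bold>\<le> \<^bold>0"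
    using mult_right_mono[OF le_alpha_zero, of "\<^bold>1" "\<alpha> \<^bold>1"] by (simp add: mult_one_left)
  then show ?thesis
    by (simp add: le_zero_iff)
qed

lemma alpha_zero: "\<alpha> \<^bold>0 = \<^bold>1"
  using alpha_one involution by metis

lemma mult_alpha_self: "x \<^bold>\<cdot> \<alpha> x = \<^bold>0"
  using lukasiewicz[of "\<^bold>1" x]
  by (simp add: mult_one_left mult_zero_right alpha_one involution)

lemma alpha_mult_self: "\<alpha> x \<^bold>\<cdot> x = \<^bold>0"
  using mult_alpha_self[of "\<alpha> x"] by (simp add: involution)

text \<open>Now 1 is the top element, so \<open>x\<close> can be enlarged to 1. Monotonicity in the
  left factor bounds the product by its right factor.\<close>

lemma mult_le_right: "x \<^bold>\<cdot> y \<^bold>\<le> y"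
  using mult_right_mono[OF le_alpha_zero, of x y] by (simp add: alpha_zero mult_one_left)

text \<open>Enlarging \<open>\<alpha> y\<close> to \<open>\<alpha> x\<close> gives the bound
  \<open>\<alpha> x \<cdot> x = 0\<close>. This turns the equation BA4 into an inequality.\<close>

lemma alpha_mult_eq_zero:
  assumes "x \<^bold>\<le> y"
  shows "\<alpha> y \<^bold>\<cdot> x = \<^bold>0"
  using mult_right_mono[OF antitone[OF assms], of x] by (simp add: alpha_mult_self le_zero_iff)

text \<open>The Lukasiewicz identity exchanges the right factor \<open>\<alpha> y\<close> for
  \<open>x\<close>, and a product lies below its right factor.\<close>

lemma alpha_mult_alpha_le: "\<alpha> (\<alpha> x \<^bold>\<cdot> \<alpha> y) \<^bold>\<cdot> \<alpha> y \<^bold>\<le> x"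
  using lukasiewicz[of "\<alpha> x" y] mult_le_right[of _ x] by (simp add: involution)

lemma oplus_eq: "\<alpha> ((\<alpha> x \<^bold>+ y) \<^bold>\<cdot> \<alpha> y) = \<alpha> (\<alpha> x \<^bold>\<cdot> \<alpha> y)"
  by (simp add: distrib_right mult_alpha_self)

lemma basic_algebra_oplus: "basic_algebra (\<lambda>x y. \<alpha> ((\<alpha> x \<^bold>+ y) \<^bold>\<cdot> \<alpha> y)) \<alpha> \<^bold>0"
  unfolding oplus_eq
proof
  fix x y z
  show "\<alpha> (\<alpha> x \<^bold>\<cdot> \<alpha> \<^bold>0) = x"
    by (simp add: alpha_zero mult_one_right involution)
  show "\<alpha> (\<alpha> x) = x"
    by (rule involution)
  show "\<alpha> (\<alpha> (\<alpha> (\<alpha> (\<alpha> (\<alpha> x) \<^bold>\<cdot> \<alpha> y))) \<^bold>\<cdot> \<alpha> y)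
      = \<alpha> (\<alpha> (\<alpha> (\<alpha> (\<alpha> (\<alpha> y) \<^bold>\<cdot> \<alpha> x))) \<^bold>\<cdot> \<alpha> x)"
    using lukasiewicz[of x y] by (simp add: involution)
  \<comment> \<open>After cancelling double negations, \<open>w\<close> is the left argument of the
    sum with \<open>z\<close> in BA4, which becomes \<open>\<alpha> (\<alpha> (\<alpha> w \<cdot>
    \<alpha> z) \<cdot> (\<alpha> x \<cdot> \<alpha> z)) = \<alpha> 0\<close>.\<close>
  define w where "w = \<alpha> (\<alpha> x \<^bold>\<cdot> \<alpha> y) \<^bold>\<cdot> \<alpha> y"
  have "\<alpha> x \<^bold>\<cdot> \<alpha> z \<^bold>\<le> \<alpha> w \<^bold>\<cdot> \<alpha> z"
    unfolding w_def by (intro mult_right_mono antitone alpha_mult_alpha_le)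
  then have "\<alpha> (\<alpha> w \<^bold>\<cdot> \<alpha> z) \<^bold>\<cdot> (\<alpha> x \<^bold>\<cdot> \<alpha> z) = \<^bold>0"
    by (rule alpha_mult_eq_zero)
  then show "\<alpha> (\<alpha> (\<alpha> (\<alpha> (\<alpha> (\<alpha> (\<alpha> (\<alpha> (\<alpha> (\<alpha> (\<alpha> x \<^bold>\<cdot> \<alpha> y))) \<^bold>\<cdot> \<alpha> y))) \<^bold>\<cdot> \<alpha> z)))
      \<^bold>\<cdot> \<alpha> (\<alpha> (\<alpha> x \<^bold>\<cdot> \<alpha> z))) = \<alpha> \<^bold>0"
    by (simp add: w_def involution)
qed

end

theorem theorem4:
  fixes add :: "'a \<Rightarrow> 'a \<Rightarrow> 'a"  (infixl "\<^bold>+" 65)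
    and mult :: "'a \<Rightarrow> 'a \<Rightarrow> 'a"  (infixl "\<^bold>\<cdot>" 70)
    and zero one :: 'a
    and \<alpha> :: "'a \<Rightarrow> 'a"
  assumes "lukasiewicz_near_semiring add mult zero one \<alpha>"
  shows "basic_algebra (\<lambda>x y. \<alpha> ((\<alpha> x \<^bold>+ y) \<^bold>\<cdot> \<alpha> y)) \<alpha> zero"
  using assms by (rule lukasiewicz_near_semiring.basic_algebra_oplus)

end
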